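(* Let $s\ge1$, let $\beta_1,\dotsc,\beta_s$ be positive integers, $|\boldsymbol\beta|=\beta_1+\dotsb+\beta_s$, and let $n$ be a positive integer. Consider the expansion of \[ F_{\boldsymbol\beta,q}[s;1]=\prod_{1\le i<j\le s}\Big(\frac{z_i}{z_j};q\Big)_{\beta_i}\Big(\frac{qz_j}{z_i};q\Big)_{\beta_j}\prod_{i=1}^s\Big(\frac{z_i}{w_1};q\Big)_{\beta_i}^{-1}. \] Then the monomial $z_1^{k_1}z_2^{k_2}\dotsm z_s^{k_s}/w_1^n$ does not appear in this expansion if $k_i<n$ for all $i=1,\dotsc,s$. Moreover, for each $a\in\{1,\dotsc,s\}$, the coefficient of $z_a^n/w_1^n$ in this expansion is \[ q^{\sum_{j=a+1}^s\beta_j}\frac{(1-q^{\beta_a})(q;q)_{|\boldsymbol\beta|-\beta_a}}{(q;q)_{\beta_1}(q;q)_{\beta_2}\dotsm(q;q)_{\beta_s}}\,(q^{|\boldsymbol\beta|-\beta_a+n+1};q)_{\beta_a-1}. \]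
   Context: $(z;q)_n=(1-z)(1-qz)\dotsm(1-q^{n-1}z)$, $(z;q)_0=1$. The expansion is the formal series obtained by expanding each factor $(1-q^bz_i/w_1)^{-1}$ as $\sum_{m\ge0}(q^bz_i/w_1)^m$ (i.e. in the region $|q^bz_i/w_1|<1$), the other factors being Laurent polynomials in the $z_i$. *)

theory Defs
  imports Complex_Main "HOL-Library.Poly_Mapping" "HOL-Computational_Algebra.Formal_Power_Series"
begin

text \<open>Exponent vectors of Laurent monomials in z_1, z_2, ...: finitely supported nat => int.
  Laurent polynomials in the z's with complex coefficients: lpoly.\<close>
type_synonym zexpo = "nat \<Rightarrow>\<^sub>0 int"
type_synonym lpoly = "zexpo \<Rightarrow>\<^sub>0 complex"

definition qpoch :: "complex \<Rightarrow> complex \<Rightarrow> nat \<Rightarrow> complex" where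
  "qpoch x q m = (\<Prod>l<m. 1 - x * q ^ l)"

definition ez :: "nat \<Rightarrow> zexpo" where
  "ez i = Poly_Mapping.single i 1"

definition qpoch_mon :: "complex \<Rightarrow> zexpo \<Rightarrow> complex \<Rightarrow> nat \<Rightarrow> lpoly" where
  "qpoch_mon c e q m = (\<Prod>l<m. 1 - Poly_Mapping.single e (c * q ^ l))"

text \<open>Formal expansion of (1 - q^b z_i / w_1)^{-1} = sum_m (q^b z_i / w_1)^m,
  as a power series in 1/w_1 (fps variable X stands for 1/w_1) with Laurent polynomial
  coefficients in the z's.\<close>
definition geom :: "complex \<Rightarrow> nat \<Rightarrow> nat \<Rightarrow> lpoly fps" where
  "geom q i b = Abs_fps (\<lambda>m. Poly_Mapping.single (Poly_Mapping.single i (int m)) (q ^ (b * m)))"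

text \<open>The expansion of F_{beta,q}[s;1]; the coefficient of z^k / w_1^n is
  lookup (fps_nth (Fexp q s beta) n) k.\<close>
definition Fexp :: "complex \<Rightarrow> nat \<Rightarrow> (nat \<Rightarrow> nat) \<Rightarrow> lpoly fps" where
  "Fexp q s \<beta> =
     fps_const (\<Prod>(i,j)\<in>{(i,j). 1 \<le> i \<and> i < j \<and> j \<le> s}.
        qpoch_mon 1 (ez i - ez j) q (\<beta> i) * qpoch_mon q (ez j - ez i) q (\<beta> j))
     * (\<Prod>i\<in>{1..s}. \<Prod>b<\<beta> i. geom q i b)"

end

theory Submission
  imports Defs "HOL-Computational_Algebra.Polynomial_FPS"
begin

text \<open>Decompose \<open>F\<close> into partial fractions in \<open>w\<^sub>1\<close>: it is the sum over \<open>i\<close> and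
  \<open>j < \<beta>\<^sub>i\<close> of \<open>A\<^sub>i\<^sub>j / (1 - q\<^sup>j z\<^sub>i / w\<^sub>1)\<close>. The poles that \<open>z\<^sub>l\<close>, \<open>l \<noteq> i\<close>,
  would contribute to \<open>A\<^sub>i\<^sub>j\<close> cancel against the Dyson product, so \<open>A\<^sub>i\<^sub>j\<close> is a Laurent polynomial
  without negative powers of \<open>z\<^sub>i\<close>. The coefficient of \<open>w\<^sub>1\<^bsup>-n\<^esup>\<close> is the sum of the
  \<open>A\<^sub>i\<^sub>j q\<^bsup>jn\<^esup> z\<^sub>i\<^sup>n\<close>, in which every monomial has some \<open>z\<^sub>i\<close>-exponent at least \<open>n\<close>, and only the
  terms \<open>A\<^sub>a\<^sub>j\<close> at \<open>z\<^sub>a = 0\<close> contribute to \<open>z\<^sub>a\<^sup>n\<close>. These are scalar multiples of the Dyson product in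
  the other variables, and the sum over \<open>j\<close> of the scalars is a coefficient of a \<open>q\<close>-binomial series. The
  remaining constant term of the Dyson product is computed by induction on the number of variables, from
  the same decomposition with \<open>n = 0\<close>.\<close>

section \<open>Partial fractions\<close>

lemma fps_geometric_mult:
  fixes c :: "'a::comm_ring_1"
  shows "Abs_fps (\<lambda>n. c ^ n) * fps_of_poly [:1, - c:] = 1"
proof -
  have L: "fps_of_poly [:1, - c:] = 1 - fps_const c * fps_X"
    by (simp add: fps_of_poly_pCons fps_of_poly_const mult.commute fps_const_neg[symmetric] del: fps_const_neg)
  have M: "Abs_fps (\<lambda>n. c ^ n) * fps_const c * fps_X = Abs_fps (\<lambda>n. c ^ n) - 1"
  proof (rule fps_ext)
    fix n
    show "fps_nth (Abs_fps (\<lambda>n. c ^ n) * fps_const c * fps_X) n = fps_nth (Abs_fps (\<lambda>n. c ^ n) - 1) n"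
      by (cases n) (simp_all add: mult.commute)
  qed
  show ?thesis
    unfolding L right_diff_distrib mult.assoc[symmetric] M by simp
qed

text \<open>After clearing denominators the claim is that \<open>p\<close> vanishes: its degree is
  below \<open>card I\<close>, yet it has the \<open>card I\<close> distinct roots
  \<open>v t\<close>. The condition on \<open>A t\<close> is multiplicative, so the coefficients may
  lie in an integral domain such as the Laurent polynomials.\<close>

lemma partial_fraction_fps:
  fixes u v A :: "'i \<Rightarrow> 'a::idom"
  assumes fin: "finite I" and ne: "I \<noteq> {}" and inj: "inj_on v I"
    and uv: "\<And>t. t \<in> I \<Longrightarrow> u t * v t = 1"
    and A: "\<And>t. t \<in> I \<Longrightarrow> A t * (\<Prod>t'\<in>I - {t}. 1 - u t' * v t) = d"
  shows "fps_nth (fps_const d * (\<Prod>t\<in>I. Abs_fps (\<lambda>n. u t ^ n))) n = (\<Sum>t\<in>I. A t * u t ^ n)"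
proof -
  define p where "p = (\<Sum>t\<in>I. smult (A t) (\<Prod>t'\<in>I - {t}. [:1, - u t':])) - [:d:]"
  define G where "G t = Abs_fps (\<lambda>n. u t ^ n)" for t
  have GL: "G t * fps_of_poly [:1, - u t:] = 1" for t
    unfolding G_def by (rule fps_geometric_mult)
  have card: "card I > 0" using fin ne by (simp add: card_gt_0_iff)
  have root: "poly p (v t) = 0" if t: "t \<in> I" for t
  proof -
    \<comment> \<open>For \<open>s\<close> other than \<open>t\<close> the product still contains
      the factor of \<open>t\<close>, which is zero because \<open>u t * v t = 1\<close>.\<close>
    have "(\<Sum>s\<in>I - {t}. A s * (\<Prod>t'\<in>I - {s}. 1 - u t' * v t)) = 0"
    proof (rule sum.neutral, rule ballI)
      fix s assume "s \<in> I - {t}"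
      then have "(\<Prod>t'\<in>I - {s}. 1 - u t' * v t) = 0"
        using fin t uv[OF t] by (intro prod_zero) (auto intro!: bexI[of _ t])
      then show "A s * (\<Prod>t'\<in>I - {s}. 1 - u t' * v t) = 0" by simp
    qed
    then have "(\<Sum>s\<in>I. A s * (\<Prod>t'\<in>I - {s}. 1 - u t' * v t)) = d"
      using sum.remove[OF fin t, of "\<lambda>s. A s * (\<Prod>t'\<in>I - {s}. 1 - u t' * v t)"] A[OF t] by simp
    then show ?thesis
      by (simp add: p_def poly_sum poly_prod mult.commute)
  qed
  have deg1: "degree (smult (A t) (\<Prod>t'\<in>I - {t}. [:1, - u t':])) \<le> card I - 1" if "t \<in> I" for t
  proof -
    have "degree (\<Prod>t'\<in>I - {t}. [:1, - u t':]) \<le> (\<Sum>t'\<in>I - {t}. degree [:1, - u t':])"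
      using fin by (intro degree_prod_sum_le[THEN order_trans]) auto
    also have "\<dots> \<le> (\<Sum>t'\<in>I - {t}. 1)" by (intro sum_mono) simp
    finally show ?thesis using that fin by (simp add: order_trans[OF degree_smult_le])
  qed
  have "degree p \<le> card I - 1"
    unfolding p_def using fin deg1 by (intro degree_diff_le degree_sum_le) auto
  \<comment> \<open>The subtraction in \<open>card I - 1\<close> is truncated; since
    \<open>I\<close> is nonempty, the bound becomes strict.\<close>
  then have deg: "degree p < card I" using card by simp
  have "p = 0"
  proof (rule ccontr)
    assume "p \<noteq> 0"
    then have "card {x. poly p x = 0} \<le> degree p" "finite {x. poly p x = 0}"
      by (auto intro: card_poly_roots_bound poly_roots_finite)
    moreover have "v ` I \<subseteq> {x. poly p x = 0}" using root by auto
    ultimately have "card (v ` I) \<le> degree p"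
      by (meson card_mono order_trans)
    then show False using deg inj by (simp add: card_image)
  qed
  then have "fps_of_poly p = 0" by simp
  then have d: "fps_const d = (\<Sum>t\<in>I. fps_const (A t) * (\<Prod>t'\<in>I - {t}. fps_of_poly [:1, - u t':]))"
    by (simp add: p_def fps_of_poly_diff fps_of_poly_sum fps_of_poly_smult fps_of_poly_prod fps_of_poly_const)
  have "fps_const d * (\<Prod>t\<in>I. G t) = (\<Sum>t\<in>I. fps_const (A t) * G t)"
    unfolding d sum_distrib_right
  proof (rule sum.cong[OF refl])
    fix t assume t: "t \<in> I"
    have "(\<Prod>t'\<in>I - {t}. fps_of_poly [:1, - u t':]) * (\<Prod>t'\<in>I - {t}. G t') = 1"
      unfolding prod.distrib[symmetric] using GL by (simp add: mult.commute)
    then show "fps_const (A t) * (\<Prod>t'\<in>I - {t}. fps_of_poly [:1, - u t':]) * prod G I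
        = fps_const (A t) * G t"
      using prod.remove[OF fin t, of G] by (simp add: algebra_simps)
  qed
  then show ?thesis by (simp add: G_def fps_sum_nth)
qed

text \<open>The q-binomial series of 1/(X;q)_(M+1), with the Gaussian binomial coefficient
  [N+M choose M] as coefficient of X^N. The claimed series \<open>H M\<close> satisfy the recursion
  \<open>step\<close>, which is the q-Pascal rule, and induction on \<open>M\<close>
  follows.\<close>

lemma fps_nth_prod_geometric:
  fixes q :: complex
  assumes q: "\<And>m. m > 0 \<Longrightarrow> q ^ m \<noteq> 1"
  shows "fps_nth (\<Prod>b<Suc M. Abs_fps (\<lambda>n. (q ^ b) ^ n)) N = qpoch (q ^ (N + 1)) q M / qpoch q q M"
proof -
  have nz: "qpoch q q M \<noteq> 0" for M
    using q by (auto simp: qpoch_def power_Suc[symmetric] simp del: power_Suc)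
  define H where "H M = Abs_fps (\<lambda>N. qpoch (q ^ (N + 1)) q M / qpoch q q M)" for M
  have step: "H (Suc M) * fps_of_poly [:1, - (q ^ Suc M):] = H M" for M
  proof (rule fps_ext)
    fix N
    have low: "qpoch q q (Suc M) = qpoch q q M * (1 - q ^ Suc M)"
      by (simp add: qpoch_def)
    have n1: "1 - q ^ Suc M \<noteq> 0" using q[of "Suc M"] by simp
    show "fps_nth (H (Suc M) * fps_of_poly [:1, - (q ^ Suc M):]) N = fps_nth (H M) N"
    proof (cases N)
      case 0
      then show ?thesis using nz[of "Suc M"] nz[of M]
        by (simp add: H_def fps_of_poly_pCons fps_of_poly_const)
    next
      case (Suc K)
      have a: "qpoch (q ^ (N + 1)) q (Suc M) = qpoch (q ^ (N + 1)) q M * (1 - q ^ (N + 1 + M))"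
        by (simp add: qpoch_def power_add)
      have b: "qpoch (q ^ (K + 1)) q (Suc M) = (1 - q ^ (K + 1)) * qpoch (q ^ (N + 1)) q M"
        unfolding qpoch_def prod.lessThan_Suc_shift by (simp add: Suc algebra_simps)
      have "fps_nth (H (Suc M) * fps_of_poly [:1, - (q ^ Suc M):]) N
          = (qpoch (q ^ (N + 1)) q (Suc M) - q ^ Suc M * qpoch (q ^ (K + 1)) q (Suc M)) / qpoch q q (Suc M)"
        by (simp add: H_def Suc fps_of_poly_pCons fps_of_poly_const algebra_simps diff_divide_distrib)
      \<comment> \<open>With \<open>N = K + 1\<close>: (1 - q^(N+1+M)) - q^(M+1) (1 - q^N) = 1 -
        q^(M+1).\<close>
      also have "\<dots> = qpoch (q ^ (N + 1)) q M * (1 - q ^ Suc M) / qpoch q q (Suc M)"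
        unfolding a b by (simp add: Suc algebra_simps power_add)
      also have "\<dots> = fps_nth (H M) N"
        unfolding low using n1 by (simp add: H_def)
      finally show ?thesis .
    qed
  qed
  have "(\<Prod>b<Suc M. Abs_fps (\<lambda>n. (q ^ b) ^ n)) = H M"
  proof (induction M)
    case 0
    show ?case by (simp add: H_def qpoch_def fps_eq_iff)
  next
    case (Suc M)
    define G where "G = Abs_fps (\<lambda>n. (q ^ Suc M) ^ n)"
    define L where "L = fps_of_poly [:1, - (q ^ Suc M):]"
    have GL: "G * L = 1" unfolding G_def L_def by (rule fps_geometric_mult)
    have HL: "H (Suc M) * L = H M" unfolding L_def by (rule step)
    have "H M * G = H (Suc M) * (G * L)"
      unfolding HL[symmetric] by (simp only: mult_ac)
    then have "H M * G = H (Suc M)" by (simp add: GL)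
    then show ?case
      using Suc unfolding G_def prod.lessThan_Suc[of _ "Suc M"] by simp
  qed
  then show ?thesis by (simp add: H_def)
qed

text \<open>Intended for \<open>Q = q\<close>, \<open>r\<close> a multiple of z_i/z_l and
  \<open>u\<close> its inverse: the denominators of z_l at a pole of z_i are traded against factors
  of the Dyson product. Raising \<open>k\<close> by one shifts the exponents in the second product
  by one, so one factor enters and one leaves; since \<open>u * r = 1\<close>, each is a multiple of
  a factor in \<open>r\<close> with the same multiplier.\<close>

lemma pair_cancel:
  fixes Q Qi u r :: "'a::comm_ring_1"
  assumes Q: "Q * Qi = 1" and ur: "u * r = 1"
  shows "(\<Prod>m<k. Q ^ B - Q ^ m * r) * (\<Prod>b<B. 1 - Q ^ (b + 1) * Qi ^ k * u)
       = (\<Prod>b<B. 1 - Q ^ (b + 1) * u) * (\<Prod>m<k. 1 - Q ^ m * r)"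
proof (induction k)
  case 0
  show ?case by simp
next
  case (Suc k)
  define P where "P k = (\<Prod>b<B. 1 - Q ^ (b + 1) * Qi ^ k * u)" for k
  have QQ: "Q ^ m * Qi ^ m = 1" for m
    by (simp add: power_mult_distrib[symmetric] Q)
  have P: "P (Suc k) * (1 - Q ^ B * Qi ^ k * u) = (1 - Qi ^ k * u) * P k"
  proof -
    have "P (Suc k) = (\<Prod>b<B. 1 - Q ^ b * Qi ^ k * u)"
      unfolding P_def
    proof (intro prod.cong refl)
      fix b
      have "Q ^ (b + 1) * Qi ^ Suc k * u = (Q * Qi) * (Q ^ b * Qi ^ k * u)"
        by (simp add: mult_ac)
      then show "1 - Q ^ (b + 1) * Qi ^ Suc k * u = 1 - Q ^ b * Qi ^ k * u"
        by (simp add: Q)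
    qed
    then have "P (Suc k) * (1 - Q ^ B * Qi ^ k * u) = (\<Prod>b<Suc B. 1 - Q ^ b * Qi ^ k * u)"
      by simp
    also have "\<dots> = (1 - Qi ^ k * u) * P k"
      unfolding P_def prod.lessThan_Suc_shift by simp
    finally show ?thesis .
  qed
  have "(Q ^ k * r) * (Q ^ B * Qi ^ k * u) = Q ^ B * (Q ^ k * Qi ^ k) * (u * r)"
    by (simp only: mult_ac)
  then have L: "Q ^ B - Q ^ k * r = - (Q ^ k * r) * (1 - Q ^ B * Qi ^ k * u)"
    by (simp add: QQ ur right_diff_distrib)
  have "(Q ^ k * r) * (Qi ^ k * u) = (Q ^ k * Qi ^ k) * (u * r)"
    by (simp only: mult_ac)
  then have R: "1 - Q ^ k * r = - (Q ^ k * r) * (1 - Qi ^ k * u)"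
    by (simp add: QQ ur right_diff_distrib)
  have "(Q ^ B - Q ^ k * r) * P (Suc k) = - (Q ^ k * r) * (P (Suc k) * (1 - Q ^ B * Qi ^ k * u))"
    unfolding L by (simp only: mult_ac)
  also have "\<dots> = (1 - Q ^ k * r) * P k"
    unfolding P R by (simp only: mult_ac)
  finally have *: "(Q ^ B - Q ^ k * r) * P (Suc k) = (1 - Q ^ k * r) * P k" .
  have "(\<Prod>m<Suc k. Q ^ B - Q ^ m * r) * P (Suc k)
      = (\<Prod>m<k. Q ^ B - Q ^ m * r) * ((Q ^ B - Q ^ k * r) * P (Suc k))"
    by (simp add: mult.assoc)
  also have "\<dots> = ((\<Prod>m<k. Q ^ B - Q ^ m * r) * P k) * (1 - Q ^ k * r)"
    unfolding * by (simp only: mult_ac)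
  also have "\<dots> = (\<Prod>b<B. 1 - Q ^ (b + 1) * u) * (\<Prod>m<Suc k. 1 - Q ^ m * r)"
    using Suc by (simp add: P_def mult.assoc)
  finally show ?case unfolding P_def .
qed

section \<open>Laurent polynomials and their values at \<open>z\<^sub>i = 0\<close>\<close>

lemma lookup_mult_single:
  fixes f :: "'a::ab_group_add \<Rightarrow>\<^sub>0 'b::semiring_0"
  shows "Poly_Mapping.lookup (f * Poly_Mapping.single e c) k = Poly_Mapping.lookup f (k - e) * c"
proof -
  have "(\<Sum>x. Poly_Mapping.lookup (Poly_Mapping.single e c) x when k = l + x) = (c when l = k - e)" for l
  proof -
    have "(\<lambda>x. Poly_Mapping.lookup (Poly_Mapping.single e c) x when k = l + x)
        = (\<lambda>x. (c when l = k - e) when x = e)"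
      by (auto simp: lookup_single fun_eq_iff when_def algebra_simps)
    then show ?thesis by (simp only: Sum_any_when_equal)
  qed
  then show ?thesis
    by (simp add: lookup_mult mult_when)
qed

lemma poly_mapping_eq_sum_single:
  assumes "finite K" "Poly_Mapping.keys f \<subseteq> K"
  shows "f = (\<Sum>k\<in>K. Poly_Mapping.single k (Poly_Mapping.lookup f k))"
proof (rule poly_mapping_eqI)
  fix x
  show "Poly_Mapping.lookup f x
      = Poly_Mapping.lookup (\<Sum>k\<in>K. Poly_Mapping.single k (Poly_Mapping.lookup f k)) x"
    using assms by (auto simp: lookup_sum lookup_single when_def in_keys_iff)
qed

abbreviation cst :: "complex \<Rightarrow> lpoly" where
  "cst \<equiv> Poly_Mapping.single 0"

lemma cst_power: "cst c ^ n = cst (c ^ n)"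
  by (induction n) (simp_all add: mult_single)

lemma one_minus_cst: "1 - cst c = cst (1 - c)"
  by (simp add: single_diff)

lemma cst_prod: "(\<Prod>x\<in>A. cst (f x)) = cst (\<Prod>x\<in>A. f x)"
  by (induction A rule: infinite_finite_induct) (simp_all add: mult_single)

lemma single_ez_power:
  "Poly_Mapping.single (ez i) c ^ n = (Poly_Mapping.single (Poly_Mapping.single i (int n)) (c ^ n) :: lpoly)"
  by (induction n) (simp_all add: ez_def mult_single single_add[symmetric])

text \<open>Puts the series into the shape of powers of a single \<open>u\<close> that
  \<open>partial_fraction_fps\<close> expects.\<close>

lemma geom_eq: "geom q i b = Abs_fps (\<lambda>n. Poly_Mapping.single (ez i) (q ^ b) ^ n)"
  by (simp add: geom_def single_ez_power power_mult)

text \<open>\<open>g\<close> is the value at \<open>z\<^sub>i = 0\<close> of \<open>f\<close>, which contains no negative power of \<open>z\<^sub>i\<close>.\<close>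
definition has_init :: "nat \<Rightarrow> lpoly \<Rightarrow> lpoly \<Rightarrow> bool" where
  "has_init i f g \<longleftrightarrow> (\<forall>k\<in>Poly_Mapping.keys (f - g). Poly_Mapping.lookup k i > 0)
     \<and> (\<forall>k\<in>Poly_Mapping.keys g. Poly_Mapping.lookup k i = 0)"

lemma has_init_self:
  "(\<And>k. k \<in> Poly_Mapping.keys g \<Longrightarrow> Poly_Mapping.lookup k i = 0) \<Longrightarrow> has_init i g g"
  by (simp add: has_init_def)

lemma has_init_cst: "has_init i (cst c) (cst c)"
  by (rule has_init_self) (auto split: if_splits)

text \<open>Setting z_i = 0 is multiplicative: in each of \<open>h * h'\<close>,
  \<open>h * g'\<close> and \<open>g * h'\<close> one factor has only positive exponents of z_i and
  the other has no negative ones.\<close>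

lemma has_init_mult:
  assumes "has_init i f g" "has_init i f' g'"
  shows "has_init i (f * f') (g * g')"
proof -
  define h h' where "h = f - g" and "h' = f' - g'"
  have hs: "Poly_Mapping.lookup k i > 0" if "k \<in> Poly_Mapping.keys h \<or> k \<in> Poly_Mapping.keys h'" for k
    using that assms unfolding has_init_def h_def h'_def by auto
  have gs: "Poly_Mapping.lookup k i = 0" if "k \<in> Poly_Mapping.keys g \<or> k \<in> Poly_Mapping.keys g'" for k
    using that assms unfolding has_init_def by auto
  have eq: "f * f' - g * g' = h * h' + h * g' + g * h'"
    unfolding h_def h'_def by (simp add: algebra_simps)
  have "Poly_Mapping.lookup k i > 0" if "k \<in> Poly_Mapping.keys (f * f' - g * g')" for k
  proof -
    have "k \<in> Poly_Mapping.keys (h * h') \<union> Poly_Mapping.keys (h * g') \<union> Poly_Mapping.keys (g * h')"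
      using that keys_add[of "h * h' + h * g'" "g * h'"] keys_add[of "h * h'" "h * g'"] unfolding eq by auto
    then obtain x y where "k = x + y"
      "x \<in> Poly_Mapping.keys h \<and> y \<in> Poly_Mapping.keys h' \<or> x \<in> Poly_Mapping.keys h \<and> y \<in> Poly_Mapping.keys g'
       \<or> x \<in> Poly_Mapping.keys g \<and> y \<in> Poly_Mapping.keys h'"
      using keys_mult[of h h'] keys_mult[of h g'] keys_mult[of g h'] by fast
    then show ?thesis using hs[of x] hs[of y] gs[of x] gs[of y] by (auto simp: lookup_add)
  qed
  moreover have "Poly_Mapping.lookup k i = 0" if k: "k \<in> Poly_Mapping.keys (g * g')" for k
  proof -
    obtain x y where "k = x + y" "x \<in> Poly_Mapping.keys g" "y \<in> Poly_Mapping.keys g'"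
      using k keys_mult[of g g'] by fast
    then show ?thesis using gs[of x] gs[of y] by (simp add: lookup_add)
  qed
  ultimately show ?thesis by (simp add: has_init_def)
qed

lemma has_init_prod:
  "(\<And>x. x \<in> A \<Longrightarrow> has_init i (f x) (g x)) \<Longrightarrow> has_init i (\<Prod>x\<in>A. f x) (\<Prod>x\<in>A. g x)"
  by (induction A rule: infinite_finite_induct) (auto intro: has_init_mult has_init_cst[of _ 1, simplified])

lemma has_init_diff_single:
  assumes "l \<noteq> i"
  shows "has_init i (cst c - Poly_Mapping.single (ez i - ez l) d) (cst c)"
proof -
  have "cst c - Poly_Mapping.single (ez i - ez l) d - cst c = Poly_Mapping.single (ez i - ez l) (- d)"
    by (simp add: single_uminus)
  then show ?thesis
    using assms by (auto simp: has_init_def lookup_minus ez_def lookup_single split: if_splits)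
qed

lemma has_init_lookup_neg:
  assumes "has_init i f g" "Poly_Mapping.lookup k i < 0"
  shows "Poly_Mapping.lookup f k = 0"
proof -
  have "Poly_Mapping.lookup (f - g) k = 0" "Poly_Mapping.lookup g k = 0"
    using assms unfolding has_init_def by (metis in_keys_iff less_asym less_irrefl)+
  then show ?thesis by (simp add: lookup_minus)
qed

lemma has_init_lookup_0:
  assumes "has_init i f g" "Poly_Mapping.lookup k i = 0"
  shows "Poly_Mapping.lookup f k = Poly_Mapping.lookup g k"
proof -
  have "Poly_Mapping.lookup (f - g) k = 0"
    using assms unfolding has_init_def by (metis in_keys_iff less_irrefl)
  then show ?thesis by (simp add: lookup_minus)
qed

section \<open>Partial fractions of the Dyson product\<close>

definition dyson_pair :: "complex \<Rightarrow> (nat \<Rightarrow> nat) \<Rightarrow> nat \<Rightarrow> nat \<Rightarrow> lpoly" where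
  "dyson_pair q \<beta> i j = qpoch_mon 1 (ez i - ez j) q (\<beta> i) * qpoch_mon q (ez j - ez i) q (\<beta> j)"

text \<open>An arbitrary set of variables is allowed because the residues, and the induction for the
  constant term, remove single variables.\<close>

definition dyson :: "complex \<Rightarrow> (nat \<Rightarrow> nat) \<Rightarrow> nat set \<Rightarrow> lpoly" where
  "dyson q \<beta> S = (\<Prod>(i,j)\<in>{(i,j). i \<in> S \<and> j \<in> S \<and> i < j}. dyson_pair q \<beta> i j)"

text \<open>The contribution of the unordered pair of \<open>i\<close> and \<open>l\<close>. The
  case distinction reflects the asymmetry of the Dyson product: the extra \<open>q\<close> goes with
  the monomial that has the larger index in its numerator.\<close>

definition dyson_factor :: "complex \<Rightarrow> (nat \<Rightarrow> nat) \<Rightarrow> nat \<Rightarrow> nat \<Rightarrow> lpoly" where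
  "dyson_factor q \<beta> i l = (if i < l then dyson_pair q \<beta> i l else dyson_pair q \<beta> l i)"

lemma dyson_remove:
  assumes fin: "finite S" and i: "i \<in> S"
  shows "dyson q \<beta> S = dyson q \<beta> (S - {i}) * (\<Prod>l\<in>S - {i}. dyson_factor q \<beta> i l)"
proof -
  define P where "P S = {(a, b). a \<in> S \<and> b \<in> S \<and> a < b}" for S :: "nat set"
  define h where "h l = (if i < l then (i, l) else (l, i))" for l
  have finP: "finite (P T)" if "finite T" for T
    by (rule finite_subset[of _ "T \<times> T"]) (use that in \<open>auto simp: P_def\<close>)
  have split: "P S = P (S - {i}) \<union> h ` (S - {i})"
  proof
    show "P S \<subseteq> P (S - {i}) \<union> h ` (S - {i})"
      unfolding P_def h_def by (auto simp: image_iff intro: less_imp_not_less)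
    show "P (S - {i}) \<union> h ` (S - {i}) \<subseteq> P S"
      using i unfolding P_def h_def by auto
  qed
  have disj: "P (S - {i}) \<inter> h ` (S - {i}) = {}"
    unfolding P_def h_def by auto
  have inj: "inj_on h (S - {i})"
    unfolding h_def by (auto intro!: inj_onI split: if_splits)
  have "dyson q \<beta> S = dyson q \<beta> (S - {i}) * (\<Prod>x\<in>h ` (S - {i}). case x of (a, b) \<Rightarrow> dyson_pair q \<beta> a b)"
    unfolding dyson_def P_def[symmetric] split
    using fin finP[of "S - {i}"] disj by (intro prod.union_disjoint) auto
  also have "(\<Prod>x\<in>h ` (S - {i}). case x of (a, b) \<Rightarrow> dyson_pair q \<beta> a b) = (\<Prod>l\<in>S - {i}. dyson_factor q \<beta> i l)"
    unfolding prod.reindex[OF inj] by (intro prod.cong) (auto simp: h_def dyson_factor_def)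
  finally show ?thesis .
qed

text \<open>The quotient of \<open>dyson_factor\<close> by the product in \<open>dyson_split_mult\<close>; it is a polynomial in
  \<open>z\<^sub>i / z\<^sub>l\<close>.\<close>
definition dyson_split :: "complex \<Rightarrow> (nat \<Rightarrow> nat) \<Rightarrow> nat \<Rightarrow> nat \<Rightarrow> nat \<Rightarrow> lpoly" where
  "dyson_split q \<beta> i j l =
    (if i < l
     then (\<Prod>m<Suc j. cst (q ^ \<beta> l) - Poly_Mapping.single (ez i - ez l) (q ^ m))
       * (\<Prod>m\<in>{Suc j..<\<beta> i}. 1 - Poly_Mapping.single (ez i - ez l) (q ^ m))
     else (\<Prod>m<j. cst (q ^ \<beta> l) - Poly_Mapping.single (ez i - ez l) (q ^ m * q))
       * (\<Prod>m\<in>{j..<\<beta> i}. 1 - Poly_Mapping.single (ez i - ez l) (q ^ m * q)))"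

lemma prod_split_lessThan:
  fixes f :: "nat \<Rightarrow> 'a::comm_monoid_mult"
  assumes "k \<le> n"
  shows "(\<Prod>m<n. f m) = (\<Prod>m<k. f m) * (\<Prod>m\<in>{k..<n}. f m)"
  using assms by (simp add: lessThan_atLeast0 prod.atLeastLessThan_concat)

text \<open>The product over \<open>b\<close> is what the denominators of z_l become at the pole
  1/w_1 = q^(-j)/z_i. It is absorbed by \<open>pair_cancel\<close>; the factors in z_i/z_l with
  index at least \<open>k\<close> stay as they are, where \<open>k \<le> \<beta> i\<close> follows
  from \<open>j < \<beta> i\<close>.\<close>

lemma dyson_split_mult:
  assumes q: "q \<noteq> 0" and j: "j < \<beta> i"
  shows "dyson_split q \<beta> i j l * (\<Prod>b<\<beta> l. 1 - Poly_Mapping.single (ez l - ez i) (q ^ b * inverse q ^ j))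
       = dyson_factor q \<beta> i l"
proof -
  define Q where "Q c k = (\<Prod>b<\<beta> l. 1 - Poly_Mapping.single (ez l - ez i) (q ^ (b + 1) * inverse q ^ k * c) :: lpoly)" for c k
  define L where "L c k = (\<Prod>m<k. cst (q ^ \<beta> l) - Poly_Mapping.single (ez i - ez l) (q ^ m * c))" for c k
  define R where "R c A = (\<Prod>m\<in>A. 1 - Poly_Mapping.single (ez i - ez l) (q ^ m * c) :: lpoly)" for c A
  have cancel: "L c k * Q (inverse c) k = Q (inverse c) 0 * R c {..<k}" if "c \<noteq> 0" for c k
    using pair_cancel[of "cst q" "cst (inverse q)" "Poly_Mapping.single (ez l - ez i) (inverse c)"
        "Poly_Mapping.single (ez i - ez l) c" "\<beta> l" k] q that
    by (simp add: cst_power mult_single L_def Q_def R_def mult.assoc del: power_Suc)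
  have R_split: "R c {..<\<beta> i} = R c {..<k} * R c {k..<\<beta> i}" if "k \<le> \<beta> i" for c k
    unfolding R_def by (rule prod_split_lessThan[OF that])
  \<comment> \<open>The exponents \<open>b + 1\<close> in \<open>Q\<close> start at 1. For
    \<open>i < l\<close> this is compensated by taking \<open>k = Suc j\<close>; otherwise the
    factor \<open>inverse q\<close> compensates it and \<open>k = j\<close>.\<close>
  have P: "(\<Prod>b<\<beta> l. 1 - Poly_Mapping.single (ez l - ez i) (q ^ b * inverse q ^ j)) =
      (if i < l then Q 1 (Suc j) else Q (inverse q) j)"
  proof -
    have "q ^ (b + 1) * inverse q ^ Suc j * 1 = q ^ b * inverse q ^ j"
      "q ^ (b + 1) * inverse q ^ j * inverse q = q ^ b * inverse q ^ j" for b
      using q by (simp_all add: field_simps)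
    then show ?thesis unfolding Q_def by presburger
  qed
  show ?thesis
  proof (cases "i < l")
    case True
    have "dyson_split q \<beta> i j l * Q 1 (Suc j) = (L 1 (Suc j) * Q 1 (Suc j)) * R 1 {Suc j..<\<beta> i}"
      using True by (simp add: dyson_split_def L_def R_def mult_ac del: prod.lessThan_Suc)
    also have "\<dots> = Q 1 0 * R 1 {..<\<beta> i}"
      using cancel[of 1 "Suc j"] R_split[of "Suc j" 1] j by (simp add: mult.assoc)
    also have "\<dots> = dyson_factor q \<beta> i l"
      using True by (simp add: dyson_factor_def dyson_pair_def qpoch_mon_def Q_def R_def mult.commute)
    finally show ?thesis using P True by simp
  next
    case False
    have "dyson_split q \<beta> i j l * Q (inverse q) j = (L q j * Q (inverse q) j) * R q {j..<\<beta> i}"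
      using False by (simp add: dyson_split_def L_def R_def mult_ac)
    also have "\<dots> = Q (inverse q) 0 * R q {..<\<beta> i}"
      using cancel[of q j] R_split[of j q] j q by (simp add: mult.assoc)
    also have "Q (inverse q) 0 = (\<Prod>b<\<beta> l. 1 - Poly_Mapping.single (ez l - ez i) (q ^ b))"
    proof -
      have "q ^ (b + 1) * inverse q ^ 0 * inverse q = q ^ b" for b
        using q by simp
      then show ?thesis unfolding Q_def by presburger
    qed
    also have "\<dots> * R q {..<\<beta> i} = dyson_factor q \<beta> i l"
      using False by (simp add: dyson_factor_def dyson_pair_def qpoch_mon_def Q_def R_def mult_ac)
    finally show ?thesis using P False by simp
  qed
qed

text \<open>At z_i = 0 only constants survive, one \<open>q ^ \<beta> l\<close> for each factor of
  the first product. That product is one factor longer when \<open>i < l\<close>, which is the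
  source of the leading power of \<open>q\<close> in the final formula.\<close>

lemma has_init_dyson_split:
  assumes "l \<noteq> i"
  shows "has_init i (dyson_split q \<beta> i j l) (cst (q ^ (\<beta> l * j + (if i < l then \<beta> l else 0))))"
proof -
  have *: "has_init i ((\<Prod>m<k. cst c - Poly_Mapping.single (ez i - ez l) (f m))
        * (\<Prod>m\<in>A. 1 - Poly_Mapping.single (ez i - ez l) (f m))) (cst (c ^ k))" for k c f and A :: "nat set"
  proof -
    have "has_init i (\<Prod>m<k. cst c - Poly_Mapping.single (ez i - ez l) (f m)) (\<Prod>m<k. cst c)"
      using assms by (intro has_init_prod has_init_diff_single)
    moreover have "has_init i (\<Prod>m\<in>A. 1 - Poly_Mapping.single (ez i - ez l) (f m)) (\<Prod>m\<in>A. cst 1)"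
      using assms has_init_diff_single[of l i 1] by (intro has_init_prod) simp
    ultimately show ?thesis
      using has_init_mult by (fastforce simp: cst_power)
  qed
  show ?thesis
  proof (cases "i < l")
    case True
    have "cst ((q ^ \<beta> l) ^ Suc j) = cst (q ^ (\<beta> l * j + \<beta> l))"
      by (simp only: power_mult[symmetric] mult_Suc_right add.commute)
    then show ?thesis
      using True *[where c = "q ^ \<beta> l" and k = "Suc j" and f = "\<lambda>m. q ^ m" and A = "{Suc j..<\<beta> i}"]
      by (simp add: dyson_split_def del: prod.lessThan_Suc)
  next
    case False
    then show ?thesis
      using *[where c = "q ^ \<beta> l" and k = j and f = "\<lambda>m. q ^ m * q" and A = "{j..<\<beta> i}"]
      by (simp add: dyson_split_def power_mult)
  qed
qed

text \<open>The remaining denominators of z_i at its own pole of index \<open>j\<close>; z_i cancels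
  in them, so the value is a scalar.\<close>

definition dyson_kappa :: "complex \<Rightarrow> nat \<Rightarrow> nat \<Rightarrow> complex" where
  "dyson_kappa q m j = (\<Prod>b\<in>{..<m} - {j}. 1 - q ^ b * inverse q ^ j)"

text \<open>The numerator \<open>A\<^sub>i\<^sub>j\<close> of \<open>1 / (1 - q\<^sup>j z\<^sub>i / w\<^sub>1)\<close>.\<close>
definition dyson_residue :: "complex \<Rightarrow> (nat \<Rightarrow> nat) \<Rightarrow> nat set \<Rightarrow> nat \<Rightarrow> nat \<Rightarrow> lpoly" where
  "dyson_residue q \<beta> S i j =
     cst (inverse (dyson_kappa q (\<beta> i) j)) * ((\<Prod>l\<in>S - {i}. dyson_split q \<beta> i j l) * dyson q \<beta> (S - {i}))"

lemma has_init_dyson: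
  assumes "i \<notin> S"
  shows "has_init i (dyson q \<beta> S) (dyson q \<beta> S)"
proof -
  have F: "has_init i (qpoch_mon c (ez a - ez b) q m) (qpoch_mon c (ez a - ez b) q m)" if "a \<noteq> i" "b \<noteq> i" for a b c m
    unfolding qpoch_mon_def
  proof (intro has_init_prod has_init_self)
    fix l k
    assume "k \<in> Poly_Mapping.keys (1 - Poly_Mapping.single (ez a - ez b) (c * q ^ l) :: lpoly)"
    then have "k = 0 \<or> k = ez a - ez b"
      using keys_diff[of "1 :: lpoly" "Poly_Mapping.single (ez a - ez b) (c * q ^ l)"]
      by (auto split: if_splits)
    then show "Poly_Mapping.lookup k i = 0"
      using that by (auto simp: ez_def lookup_minus lookup_single)
  qed
  then show ?thesis
    unfolding dyson_def dyson_pair_def using assms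
    by (intro has_init_prod) (auto intro!: has_init_mult F)
qed

definition dyson_tail :: "(nat \<Rightarrow> nat) \<Rightarrow> nat set \<Rightarrow> nat \<Rightarrow> nat" where
  "dyson_tail \<beta> S a = (\<Sum>l\<in>{l\<in>S. a < l}. \<beta> l)"

text \<open>Setting z_i = 0 turns every \<open>dyson_split\<close> into a power of \<open>q\<close>,
  so a scalar multiple of the Dyson product in the other variables remains.\<close>

lemma has_init_dyson_residue:
  assumes fin: "finite S"
  shows "has_init i (dyson_residue q \<beta> S i j)
    (cst (inverse (dyson_kappa q (\<beta> i) j) * q ^ (sum \<beta> (S - {i}) * j + dyson_tail \<beta> S i)) * dyson q \<beta> (S - {i}))"
proof -
  have "has_init i (\<Prod>l\<in>S - {i}. dyson_split q \<beta> i j l)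
      (\<Prod>l\<in>S - {i}. cst (q ^ (\<beta> l * j + (if i < l then \<beta> l else 0))))"
    by (intro has_init_prod has_init_dyson_split) auto
  moreover have "(\<Sum>l\<in>S - {i}. if i < l then \<beta> l else 0) = dyson_tail \<beta> S i"
    unfolding dyson_tail_def using fin
    by (subst sum.inter_filter[symmetric]) (auto intro!: sum.cong)
  then have "(\<Prod>l\<in>S - {i}. cst (q ^ (\<beta> l * j + (if i < l then \<beta> l else 0))))
      = cst (q ^ (sum \<beta> (S - {i}) * j + dyson_tail \<beta> S i))"
    by (simp add: cst_prod power_sum[symmetric] sum.distrib sum_distrib_right)
  ultimately have "has_init i (dyson_residue q \<beta> S i j)
      (cst (inverse (dyson_kappa q (\<beta> i) j)) * (cst (q ^ (sum \<beta> (S - {i}) * j + dyson_tail \<beta> S i)) * dyson q \<beta> (S - {i})))"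
    unfolding dyson_residue_def by (intro has_init_mult has_init_cst has_init_dyson) auto
  then show ?thesis by (simp add: mult.assoc[symmetric] mult_single)
qed

definition Fexp_on :: "complex \<Rightarrow> (nat \<Rightarrow> nat) \<Rightarrow> nat set \<Rightarrow> lpoly fps" where
  "Fexp_on q \<beta> S = fps_const (dyson q \<beta> S) * (\<Prod>i\<in>S. \<Prod>b<\<beta> i. geom q i b)"

lemma Fexp_eq: "Fexp q s \<beta> = Fexp_on q \<beta> {1..s}"
proof -
  have "{(i, j). 1 \<le> i \<and> i < j \<and> j \<le> s} = {(i, j). i \<in> {1..s} \<and> j \<in> {1..s} \<and> i < j}"
    by auto
  then show ?thesis
    by (simp add: Fexp_def Fexp_on_def dyson_def dyson_pair_def)
qed

section \<open>Coefficients for \<open>q\<close> neither zero nor a root of unity\<close>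

locale generic =
  fixes q :: complex
  assumes q_nonzero: "q \<noteq> 0" and q_power: "\<And>m. m > 0 \<Longrightarrow> q ^ m \<noteq> 1"
begin

text \<open>This keeps the poles of a single variable distinct and the scalars
  \<open>dyson_kappa\<close> nonzero.\<close>

lemma power_inject: "q ^ a = q ^ b \<longleftrightarrow> a = b"
proof -
  have "a = b" if "a \<le> b" "q ^ a = q ^ b" for a b
  proof (rule ccontr)
    assume "a \<noteq> b"
    then have "q ^ (b - a) \<noteq> 1" using that by (intro q_power) simp
    moreover have "q ^ a * q ^ (b - a) = q ^ b"
      by (simp only: power_add[symmetric] le_add_diff_inverse that(1))
    ultimately show False using q_nonzero that(2) by simp
  qed
  then show ?thesis by (metis nle_le)
qed

lemma qpoch_nonzero: "qpoch q q m \<noteq> 0"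
  using q_power by (auto simp: qpoch_def power_Suc[symmetric] simp del: power_Suc)

lemma kappa_nonzero: "dyson_kappa q m j \<noteq> 0"
proof -
  have "1 - q ^ b * inverse q ^ j \<noteq> 0" if "b \<noteq> j" for b
    using that power_inject[of b j] q_nonzero by (auto simp: field_simps)
  then show ?thesis by (simp add: dyson_kappa_def)
qed

text \<open>The coefficient of X^N in the product of the 1/(1 - q^b X) with \<open>b < m\<close> is
  computed twice: by partial fractions, where the numerators are the inverses of
  \<open>dyson_kappa\<close>, and by the q-binomial series.\<close>

lemma sum_inverse_kappa:
  assumes "m > 0"
  shows "(\<Sum>j<m. inverse (dyson_kappa q m j) * q ^ (N * j)) = qpoch (q ^ (N + 1)) q (m - 1) / qpoch q q (m - 1)"
proof -
  have "fps_nth (fps_const 1 * (\<Prod>b<m. Abs_fps (\<lambda>n. (q ^ b) ^ n))) N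
      = (\<Sum>j<m. inverse (dyson_kappa q m j) * (q ^ j) ^ N)"
  proof (rule partial_fraction_fps)
    show "inj_on (\<lambda>j. inverse q ^ j) {..<m}"
      using power_inject by (auto simp: inj_on_def power_inverse)
    show "inverse (dyson_kappa q m t) * (\<Prod>t'\<in>{..<m} - {t}. 1 - q ^ t' * inverse q ^ t) = 1" for t
      using kappa_nonzero[of m t] by (simp add: dyson_kappa_def)
  qed (use assms q_nonzero in \<open>auto simp: power_inverse\<close>)
  moreover have "fps_nth (\<Prod>b<m. Abs_fps (\<lambda>n. (q ^ b) ^ n)) N = qpoch (q ^ (N + 1)) q (m - 1) / qpoch q q (m - 1)"
    using fps_nth_prod_geometric[of q "m - 1" N] q_power assms by simp
  ultimately show ?thesis
    by (simp add: power_mult[symmetric] mult.commute)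
qed

lemma Fexp_on_nth:
  assumes fin: "finite S" and ne: "S \<noteq> {}" and pos: "\<forall>i\<in>S. \<beta> i > 0"
  shows "fps_nth (Fexp_on q \<beta> S) n = (\<Sum>i\<in>S. \<Sum>j<\<beta> i.
           dyson_residue q \<beta> S i j * Poly_Mapping.single (Poly_Mapping.single i (int n)) (q ^ (n * j)))"
proof -
  define I where "I = Sigma S (\<lambda>i. {..<\<beta> i})"
  define u v :: "nat \<times> nat \<Rightarrow> lpoly"
    where "u = (\<lambda>(i, j). Poly_Mapping.single (ez i) (q ^ j))"
      and "v = (\<lambda>(i, j). Poly_Mapping.single (- ez i) (inverse q ^ j))"
  define A where "A = (\<lambda>(i, j). dyson_residue q \<beta> S i j)"
  have uv: "u (l, b) * v (i, j) = Poly_Mapping.single (ez l - ez i) (q ^ b * inverse q ^ j)" for l b i j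
    by (simp add: u_def v_def mult_single)
  have "fps_nth (fps_const (dyson q \<beta> S) * (\<Prod>t\<in>I. Abs_fps (\<lambda>n. u t ^ n))) n = (\<Sum>t\<in>I. A t * u t ^ n)"
  proof (rule partial_fraction_fps)
    show "finite I" using fin by (simp add: I_def)
    show "I \<noteq> {}" using ne pos by (auto simp: I_def)
    show "u t * v t = 1" for t
      using q_nonzero by (cases t) (simp add: uv power_mult_distrib[symmetric])
    \<comment> \<open>The exponent of the monomial determines \<open>i\<close>; its coefficient then
      determines \<open>j\<close>.\<close>
    show "inj_on v I"
    proof (rule inj_onI, clarify)
      fix i j i' j' assume "v (i, j) = v (i', j')"
      then have e: "Poly_Mapping.single (- ez i) (inverse q ^ j) = (Poly_Mapping.single (- ez i') (inverse q ^ j') :: lpoly)"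
        by (simp add: v_def)
      have "ez i = ez i'"
        using arg_cong[OF e, of Poly_Mapping.keys] q_nonzero by simp
      moreover from this have "q ^ j = q ^ j'"
        using arg_cong[OF e, of "\<lambda>f. Poly_Mapping.lookup f (- ez i)"] by (simp add: power_inverse)
      ultimately show "i = i' \<and> j = j'"
        using power_inject arg_cong[of "ez i" "ez i'" Poly_Mapping.keys] by (simp add: ez_def frag_of_eq)
    qed
    show "A t * (\<Prod>t'\<in>I - {t}. 1 - u t' * v t) = dyson q \<beta> S" if t: "t \<in> I" for t
    proof -
      obtain i j where ij: "t = (i, j)" "i \<in> S" "j < \<beta> i"
        using t by (auto simp: I_def)
      \<comment> \<open>\<open>B\<close> collects the remaining denominators of z_i, which give
        \<open>dyson_kappa\<close>; \<open>C\<close> collects those of the other variables, which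
        combine with the \<open>dyson_split\<close> factors to give the missing part of the Dyson
        product.\<close>
      define B where "B = {i} \<times> ({..<\<beta> i} - {j})"
      define C where "C = Sigma (S - {i}) (\<lambda>l. {..<\<beta> l})"
      have "I - {t} = B \<union> C" "B \<inter> C = {}" "finite B" "finite C"
        using ij fin by (auto simp: I_def B_def C_def)
      then have "(\<Prod>t'\<in>I - {t}. 1 - u t' * v t) = (\<Prod>t'\<in>B. 1 - u t' * v t) * (\<Prod>t'\<in>C. 1 - u t' * v t)"
        by (simp add: prod.union_disjoint)
      also have "(\<Prod>t'\<in>B. 1 - u t' * v t) = cst (dyson_kappa q (\<beta> i) j)"
        unfolding B_def prod.cartesian_product'
        by (simp add: ij uv dyson_kappa_def cst_prod[symmetric] one_minus_cst)
      also have "(\<Prod>t'\<in>C. 1 - u t' * v t)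
          = (\<Prod>l\<in>S - {i}. \<Prod>b<\<beta> l. 1 - Poly_Mapping.single (ez l - ez i) (q ^ b * inverse q ^ j))"
        unfolding C_def using fin by (subst prod.Sigma) (auto simp: ij uv intro!: prod.cong)
      finally have "A t * (\<Prod>t'\<in>I - {t}. 1 - u t' * v t)
          = (cst (inverse (dyson_kappa q (\<beta> i) j)) * cst (dyson_kappa q (\<beta> i) j)) * (dyson q \<beta> (S - {i}) *
            (\<Prod>l\<in>S - {i}. dyson_split q \<beta> i j l * (\<Prod>b<\<beta> l. 1 - Poly_Mapping.single (ez l - ez i) (q ^ b * inverse q ^ j))))"
        unfolding prod.distrib by (simp add: A_def ij dyson_residue_def mult_ac)
      also have "\<dots> = dyson q \<beta> (S - {i}) * (\<Prod>l\<in>S - {i}. dyson_factor q \<beta> i l)"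
        using dyson_split_mult[of q j \<beta> i] q_nonzero ij kappa_nonzero[of "\<beta> i" j]
        by (simp add: mult_single)
      also have "\<dots> = dyson q \<beta> S"
        using dyson_remove[OF fin ij(2)] by simp
      finally show ?thesis .
    qed
  qed
  moreover have "(\<Prod>t\<in>I. Abs_fps (\<lambda>n. u t ^ n)) = (\<Prod>i\<in>S. \<Prod>b<\<beta> i. geom q i b)"
    unfolding I_def using fin
    by (subst prod.Sigma) (auto simp: u_def geom_eq intro!: prod.cong)
  moreover have "(\<Sum>t\<in>I. A t * u t ^ n) = (\<Sum>i\<in>S. \<Sum>j<\<beta> i.
      dyson_residue q \<beta> S i j * Poly_Mapping.single (Poly_Mapping.single i (int n)) (q ^ (n * j)))"
    unfolding I_def using fin
    by (subst sum.Sigma)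
      (auto simp: u_def A_def single_ez_power power_mult[symmetric] mult.commute[of n] intro!: sum.cong)
  ultimately show ?thesis by (simp add: Fexp_on_def)
qed

lemma lookup_Fexp_on:
  assumes fin: "finite S" and ne: "S \<noteq> {}" and pos: "\<forall>i\<in>S. \<beta> i > 0"
  shows "Poly_Mapping.lookup (fps_nth (Fexp_on q \<beta> S) n) k = (\<Sum>i\<in>S. \<Sum>j<\<beta> i.
           Poly_Mapping.lookup (dyson_residue q \<beta> S i j) (k - Poly_Mapping.single i (int n)) * q ^ (n * j))"
  by (simp add: Fexp_on_nth[OF assms] lookup_sum lookup_mult_single)

text \<open>The term of index \<open>i\<close> could contribute only through a monomial of its
  residue with z_i-exponent k_i - n < 0, and there is none.\<close>

lemma lookup_Fexp_on_eq_0: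
  assumes "finite S" "S \<noteq> {}" "\<forall>i\<in>S. \<beta> i > 0"
    and "\<And>i. i \<in> S \<Longrightarrow> Poly_Mapping.lookup k i < int n"
  shows "Poly_Mapping.lookup (fps_nth (Fexp_on q \<beta> S) n) k = 0"
  unfolding lookup_Fexp_on[OF assms(1-3)] using assms
  by (intro sum.neutral ballI)
    (simp add: has_init_lookup_neg[OF has_init_dyson_residue] lookup_minus)

text \<open>The constant coefficient of a residue is visible at z_a = 0. The exponents of
  \<open>q\<close> linear in \<open>j\<close> add up to
  \<open>(sum \<beta> (S - {a}) + n) * j\<close>, so \<open>sum_inverse_kappa\<close>
  applies.\<close>

lemma sum_residue_0:
  assumes fin: "finite S" and pos: "\<beta> a > 0"
  shows "(\<Sum>j<\<beta> a. Poly_Mapping.lookup (dyson_residue q \<beta> S a j) 0 * q ^ (n * j))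
    = q ^ dyson_tail \<beta> S a * qpoch (q ^ (sum \<beta> (S - {a}) + n + 1)) q (\<beta> a - 1) / qpoch q q (\<beta> a - 1)
      * Poly_Mapping.lookup (dyson q \<beta> (S - {a})) 0"
proof -
  have cst_lookup: "Poly_Mapping.lookup (cst c * f) 0 = c * Poly_Mapping.lookup f 0" for c f
    by (simp add: lookup_mult_single mult.commute[of "cst c"])
  have "(\<Sum>j<\<beta> a. Poly_Mapping.lookup (dyson_residue q \<beta> S a j) 0 * q ^ (n * j))
    = (\<Sum>j<\<beta> a. inverse (dyson_kappa q (\<beta> a) j) * q ^ ((sum \<beta> (S - {a}) + n) * j))
      * (q ^ dyson_tail \<beta> S a * Poly_Mapping.lookup (dyson q \<beta> (S - {a})) 0)"
    unfolding sum_distrib_right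
  proof (intro sum.cong refl)
    fix j
    have "Poly_Mapping.lookup (dyson_residue q \<beta> S a j) 0 = inverse (dyson_kappa q (\<beta> a) j)
        * q ^ (sum \<beta> (S - {a}) * j + dyson_tail \<beta> S a) * Poly_Mapping.lookup (dyson q \<beta> (S - {a})) 0"
      using has_init_lookup_0[OF has_init_dyson_residue[OF fin], of 0] by (simp add: cst_lookup)
    then show "Poly_Mapping.lookup (dyson_residue q \<beta> S a j) 0 * q ^ (n * j)
        = inverse (dyson_kappa q (\<beta> a) j) * q ^ ((sum \<beta> (S - {a}) + n) * j)
          * (q ^ dyson_tail \<beta> S a * Poly_Mapping.lookup (dyson q \<beta> (S - {a})) 0)"
      by (simp add: power_add algebra_simps)
  qed
  then show ?thesis
    by (simp add: sum_inverse_kappa[OF pos])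
qed

section \<open>The constant term of the Dyson product and the coefficient of z_a^n\<close>

lemma qpoch_add: "qpoch x r (a + b) = qpoch x r a * qpoch (x * r ^ a) r b"
  by (induction b) (simp_all add: qpoch_def power_add mult.assoc)

text \<open>The sum telescopes along the order of the indices: a new minimum has all the old indices
  in its tail and leaves their tails unchanged.\<close>

lemma sum_dyson_tail:
  assumes "finite S"
  shows "(\<Sum>a\<in>S. x ^ dyson_tail \<beta> S a * (1 - x ^ \<beta> a)) = 1 - (x :: complex) ^ sum \<beta> S"
  using assms
proof (induction S rule: finite_linorder_min_induct)
  case (insert b A)
  have "{l \<in> insert b A. b < l} = A" "\<And>a. a \<in> A \<Longrightarrow> {l \<in> insert b A. a < l} = {l \<in> A. a < l}"
    using insert.hyps by auto
  then have "dyson_tail \<beta> (insert b A) b = sum \<beta> A"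
    and "\<And>a. a \<in> A \<Longrightarrow> dyson_tail \<beta> (insert b A) a = dyson_tail \<beta> A a"
    by (simp_all add: dyson_tail_def)
  moreover have "b \<notin> A" using insert.hyps by auto
  ultimately show ?case
    using insert by (simp add: power_add algebra_simps)
qed simp

text \<open>The factor \<open>1 - q ^ \<beta> a\<close> arises from completing the denominator (q;q)
  of length \<open>\<beta> a - 1\<close> to length \<open>\<beta> a\<close>. The constant term for
  the other variables is a hypothesis, so that the lemma can serve in the induction that establishes
  it.\<close>

lemma sum_residue_closed_form:
  assumes fin: "finite S" and a: "a \<in> S" and pos: "\<beta> a > 0"
    and D: "Poly_Mapping.lookup (dyson q \<beta> (S - {a})) 0
      = qpoch q q (sum \<beta> (S - {a})) / (\<Prod>i\<in>S - {a}. qpoch q q (\<beta> i))"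
  shows "(\<Sum>j<\<beta> a. Poly_Mapping.lookup (dyson_residue q \<beta> S a j) 0 * q ^ (n * j))
    = q ^ dyson_tail \<beta> S a * (1 - q ^ \<beta> a) * qpoch q q (sum \<beta> (S - {a})) / (\<Prod>i\<in>S. qpoch q q (\<beta> i))
      * qpoch (q ^ (sum \<beta> (S - {a}) + n + 1)) q (\<beta> a - 1)"
proof -
  obtain m where m: "\<beta> a = Suc m" using pos gr0_implies_Suc by blast
  have P: "qpoch q q (\<beta> a) = qpoch q q (\<beta> a - 1) * (1 - q ^ \<beta> a)"
    by (simp add: m qpoch_def)
  have "1 - q ^ \<beta> a \<noteq> 0" using q_power[OF pos] by simp
  then show ?thesis
    unfolding sum_residue_0[where \<beta> = \<beta> and a = a, OF fin pos] D prod.remove[OF fin a, of "\<lambda>i. qpoch q q (\<beta> i)"] P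
    using qpoch_nonzero by simp
qed

text \<open>The q-Dyson theorem. The coefficient of w_1^0 in the expansion is the Dyson product
  itself, so its constant term is the sum of the contributions of all \<open>a\<close> for n = 0. By
  induction these agree up to the factors summed in \<open>sum_dyson_tail\<close>.\<close>

theorem lookup_dyson_0:
  assumes "finite S" "\<forall>i\<in>S. \<beta> i > 0"
  shows "Poly_Mapping.lookup (dyson q \<beta> S) 0 = qpoch q q (sum \<beta> S) / (\<Prod>i\<in>S. qpoch q q (\<beta> i))"
  using assms
proof (induction S rule: finite_psubset_induct)
  case (psubset S)
  note fin = \<open>finite S\<close>
  show ?case
  proof (cases "S = {}")
    case True
    then show ?thesis by (simp add: dyson_def qpoch_def)
  next
    case False
    have "fps_nth (\<Prod>x\<in>X. f x) 0 = (\<Prod>x\<in>X. fps_nth (f x) 0)"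
      for X :: "nat set" and f :: "nat \<Rightarrow> lpoly fps"
      by (induction X rule: infinite_finite_induct) simp_all
    then have F0: "fps_nth (Fexp_on q \<beta> S) 0 = dyson q \<beta> S"
      by (simp add: Fexp_on_def geom_def)
    have summand: "(\<Sum>j<\<beta> a. Poly_Mapping.lookup (dyson_residue q \<beta> S a j) 0)
      = q ^ dyson_tail \<beta> S a * (1 - q ^ \<beta> a) * (qpoch q q (sum \<beta> S - 1) / (\<Prod>i\<in>S. qpoch q q (\<beta> i)))"
      if a: "a \<in> S" for a
    proof -
      define m where "m = \<beta> a - 1"
      have m: "\<beta> a = Suc m" using psubset.prems a by (simp add: m_def)
      \<comment> \<open>The two q-shifted factorials in the closed form are adjacent stretches and
        merge into one that does not depend on \<open>a\<close>.\<close>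
      have "sum \<beta> S - 1 = sum \<beta> (S - {a}) + m"
        using sum.remove[OF fin a, of \<beta>] m by simp
      then have Q: "qpoch q q (sum \<beta> S - 1)
          = qpoch q q (sum \<beta> (S - {a})) * qpoch (q ^ (sum \<beta> (S - {a}) + 1)) q m"
        using qpoch_add[of q q "sum \<beta> (S - {a})" m] by simp
      have "Poly_Mapping.lookup (dyson q \<beta> (S - {a})) 0
          = qpoch q q (sum \<beta> (S - {a})) / (\<Prod>i\<in>S - {a}. qpoch q q (\<beta> i))"
        using psubset.prems a by (intro psubset.IH) auto
      from sum_residue_closed_form[where \<beta> = \<beta> and n = 0, OF fin a _ this] psubset.prems a
      show ?thesis unfolding Q by (simp add: m)
    qed
    have "Poly_Mapping.lookup (dyson q \<beta> S) 0
        = (\<Sum>a\<in>S. \<Sum>j<\<beta> a. Poly_Mapping.lookup (dyson_residue q \<beta> S a j) 0)"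
      using lookup_Fexp_on[OF fin False psubset.prems, of 0 0] by (simp add: F0)
    also have "\<dots> = (1 - q ^ sum \<beta> S) * (qpoch q q (sum \<beta> S - 1) / (\<Prod>i\<in>S. qpoch q q (\<beta> i)))"
      unfolding sum_dyson_tail[OF fin, symmetric] sum_distrib_right
      by (intro sum.cong refl summand)
    also have "\<dots> = qpoch q q (sum \<beta> S) / (\<Prod>i\<in>S. qpoch q q (\<beta> i))"
    proof -
      obtain a where a: "a \<in> S" using False by auto
      have "sum \<beta> S > 0"
        using psubset.prems a fin sum.remove[OF fin a, of \<beta>] by simp
      then obtain m where "sum \<beta> S = Suc m" using gr0_implies_Suc by blast
      then have "qpoch q q (sum \<beta> S) = qpoch q q (sum \<beta> S - 1) * (1 - q ^ sum \<beta> S)"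
        by (simp add: qpoch_def)
      then show ?thesis by simp
    qed
    finally show ?thesis .
  qed
qed

text \<open>For \<open>i\<close> other than \<open>a\<close> the residue is read at z_i-exponent -n
  < 0, where it vanishes; for \<open>i = a\<close> it is read at exponent 0.\<close>

lemma lookup_Fexp_on_single:
  assumes fin: "finite S" and pos: "\<forall>i\<in>S. \<beta> i > 0" and a: "a \<in> S" and n: "n > 0"
  shows "Poly_Mapping.lookup (fps_nth (Fexp_on q \<beta> S) n) (Poly_Mapping.single a (int n))
    = q ^ dyson_tail \<beta> S a * (1 - q ^ \<beta> a) * qpoch q q (sum \<beta> (S - {a})) / (\<Prod>i\<in>S. qpoch q q (\<beta> i))
      * qpoch (q ^ (sum \<beta> (S - {a}) + n + 1)) q (\<beta> a - 1)"
proof -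
  let ?c = "\<lambda>i. \<Sum>j<\<beta> i. Poly_Mapping.lookup (dyson_residue q \<beta> S i j)
    (Poly_Mapping.single a (int n) - Poly_Mapping.single i (int n)) * q ^ (n * j)"
  have "?c i = 0" if "i \<in> S - {a}" for i
    using that n
    by (intro sum.neutral ballI)
      (simp add: has_init_lookup_neg[OF has_init_dyson_residue[OF fin]] lookup_minus lookup_single)
  then have "sum ?c S = ?c a"
    using sum.remove[OF fin a, of ?c] by simp
  moreover have "Poly_Mapping.lookup (fps_nth (Fexp_on q \<beta> S) n) (Poly_Mapping.single a (int n)) = sum ?c S"
    using fin pos a by (intro lookup_Fexp_on) auto
  ultimately show ?thesis
    using sum_residue_closed_form[where \<beta> = \<beta> and n = n, OF fin a] lookup_dyson_0[of "S - {a}" \<beta>] fin pos a by simp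
qed

end

section \<open>Polynomial dependence on \<open>q\<close>\<close>

text \<open>The partial fraction argument needs \<open>q\<close> to be neither zero nor a root of unity. The general
  case follows since all the coefficients involved are polynomials in \<open>q\<close>.\<close>
definition poly_fun :: "(complex \<Rightarrow> complex) \<Rightarrow> bool" where
  "poly_fun f \<longleftrightarrow> (\<exists>p. \<forall>x. f x = poly p x)"

lemma poly_fun_const: "poly_fun (\<lambda>x. c)"
  unfolding poly_fun_def by (intro exI[of _ "[:c:]"]) simp

lemma poly_fun_ident: "poly_fun (\<lambda>x. x)"
  unfolding poly_fun_def by (intro exI[of _ "[:0, 1:]"]) simp

lemma poly_fun_add: "poly_fun f \<Longrightarrow> poly_fun g \<Longrightarrow> poly_fun (\<lambda>x. f x + g x)"
  unfolding poly_fun_def by (metis poly_add)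

lemma poly_fun_diff: "poly_fun f \<Longrightarrow> poly_fun g \<Longrightarrow> poly_fun (\<lambda>x. f x - g x)"
  unfolding poly_fun_def by (metis poly_diff)

lemma poly_fun_mult: "poly_fun f \<Longrightarrow> poly_fun g \<Longrightarrow> poly_fun (\<lambda>x. f x * g x)"
  unfolding poly_fun_def by (metis poly_mult)

lemma poly_fun_power: "poly_fun f \<Longrightarrow> poly_fun (\<lambda>x. f x ^ n)"
  unfolding poly_fun_def by (metis poly_power)

lemma poly_fun_sum: "(\<And>i. i \<in> A \<Longrightarrow> poly_fun (f i)) \<Longrightarrow> poly_fun (\<lambda>x. \<Sum>i\<in>A. f i x)"
  by (induction A rule: infinite_finite_induct) (simp_all add: poly_fun_const poly_fun_add)

lemma poly_fun_prod: "(\<And>i. i \<in> A \<Longrightarrow> poly_fun (f i)) \<Longrightarrow> poly_fun (\<lambda>x. \<Prod>i\<in>A. f i x)"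
  by (induction A rule: infinite_finite_induct) (simp_all add: poly_fun_const poly_fun_mult)

lemmas poly_fun_intros = poly_fun_const poly_fun_ident poly_fun_add poly_fun_diff poly_fun_mult
  poly_fun_power poly_fun_sum poly_fun_prod

lemma poly_fun_qpoch: "poly_fun f \<Longrightarrow> poly_fun (\<lambda>q. qpoch (f q) q m)"
  unfolding qpoch_def by (intro poly_fun_intros)

text \<open>The integers from 2 on are generic, and polynomials that agree at infinitely many points
  are equal.\<close>

lemma poly_fun_eqI:
  assumes f: "poly_fun f" and g: "poly_fun g" and eq: "\<And>q. generic q \<Longrightarrow> f q = g q"
  shows "f x = g x"
proof -
  obtain p r where p: "\<And>x. f x = poly p x" and r: "\<And>x. g x = poly r x"
    using f g unfolding poly_fun_def by metis
  have gen: "generic (of_nat (k + 2))" for k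
  proof
    fix m :: nat assume "m > 0"
    then have "(k + 2) ^ m \<noteq> 1" by simp
    then show "(of_nat (k + 2) :: complex) ^ m \<noteq> 1"
      by (metis of_nat_1 of_nat_eq_iff of_nat_power)
  qed (simp only: of_nat_eq_0_iff)
  have "p - r = 0"
  proof (rule ccontr)
    assume "p - r \<noteq> 0"
    then have "finite {x. poly (p - r) x = 0}" by (rule poly_roots_finite)
    moreover have "range (\<lambda>k. of_nat (k + 2)) \<subseteq> {x. poly (p - r) x = 0}"
      using eq[OF gen] p r by auto
    moreover have "infinite (range (\<lambda>k. of_nat (k + 2) :: complex))"
      by (intro range_inj_infinite injI) simp
    ultimately show False using finite_subset by blast
  qed
  then show ?thesis by (simp add: p r)
qed

text \<open>The support may vary with \<open>q\<close>; the common finite bound \<open>K\<close>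
  lets coefficients of products be written as sums over an index set independent of
  \<open>q\<close>.\<close>

definition poly_family :: "(complex \<Rightarrow> lpoly) \<Rightarrow> bool" where
  "poly_family f \<longleftrightarrow> (\<exists>K. finite K \<and> (\<forall>q. Poly_Mapping.keys (f q) \<subseteq> K))
     \<and> (\<forall>k. poly_fun (\<lambda>q. Poly_Mapping.lookup (f q) k))"

lemma poly_family_single:
  assumes "poly_fun f"
  shows "poly_family (\<lambda>q. Poly_Mapping.single e (f q))"
proof -
  have "poly_fun (\<lambda>q. Poly_Mapping.lookup (Poly_Mapping.single e (f q)) k)" for k
    using assms by (cases "e = k") (simp_all add: lookup_single poly_fun_const)
  moreover have "\<exists>K. finite K \<and> (\<forall>q. Poly_Mapping.keys (Poly_Mapping.single e (f q)) \<subseteq> K)"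
    by (intro exI[of _ "{e}"]) simp
  ultimately show ?thesis by (simp add: poly_family_def)
qed

lemma poly_family_zero: "poly_family (\<lambda>q. 0)"
  using poly_family_single[of "\<lambda>_. 0" 0] by (simp add: poly_fun_const)

lemma poly_family_one: "poly_family (\<lambda>q. 1)"
  using poly_family_single[of "\<lambda>_. 1" 0] by (simp add: poly_fun_const)

lemma poly_family_add:
  assumes "poly_family f" "poly_family g"
  shows "poly_family (\<lambda>q. f q + g q)"
proof -
  obtain K L where "finite K" "\<And>q. Poly_Mapping.keys (f q) \<subseteq> K" "finite L" "\<And>q. Poly_Mapping.keys (g q) \<subseteq> L"
    using assms unfolding poly_family_def by metis
  then have "\<exists>K. finite K \<and> (\<forall>q. Poly_Mapping.keys (f q + g q) \<subseteq> K)"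
    by (intro exI[of _ "K \<union> L"]) (meson finite_UnI keys_add Un_mono order_trans)
  then show ?thesis
    using assms by (simp add: poly_family_def lookup_add poly_fun_add)
qed

lemma poly_family_mult:
  assumes "poly_family f" "poly_family g"
  shows "poly_family (\<lambda>q. f q * g q)"
proof -
  obtain K L where K: "finite K" "\<And>q. Poly_Mapping.keys (f q) \<subseteq> K"
    and L: "finite L" "\<And>q. Poly_Mapping.keys (g q) \<subseteq> L"
    using assms unfolding poly_family_def by metis
  have "Poly_Mapping.keys (f q * g q) \<subseteq> (\<lambda>(x, y). x + y) ` (K \<times> L)" for q
    using keys_mult[of "f q" "g q"] K(2)[of q] L(2)[of q] by fastforce
  then have "\<exists>K. finite K \<and> (\<forall>q. Poly_Mapping.keys (f q * g q) \<subseteq> K)"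
    using K(1) L(1) by (intro exI[of _ "(\<lambda>(x, y). x + y) ` (K \<times> L)"]) simp
  moreover have "poly_fun (\<lambda>q. Poly_Mapping.lookup (f q * g q) k)" for k
  proof -
    have "Poly_Mapping.lookup (f q * g q) k
        = (\<Sum>l\<in>K. Poly_Mapping.lookup (g q) (k - l) * Poly_Mapping.lookup (f q) l)" for q
      by (subst poly_mapping_eq_sum_single[OF K])
        (simp add: mult.commute[of _ "g q"] sum_distrib_left lookup_sum lookup_mult_single)
    moreover have "poly_fun (\<lambda>q. \<Sum>l\<in>K. Poly_Mapping.lookup (g q) (k - l) * Poly_Mapping.lookup (f q) l)"
      using assms by (intro poly_fun_sum poly_fun_mult) (simp_all add: poly_family_def)
    ultimately show ?thesis by simp
  qed
  ultimately show ?thesis by (simp add: poly_family_def)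
qed

lemma poly_family_sum: "(\<And>i. i \<in> A \<Longrightarrow> poly_family (f i)) \<Longrightarrow> poly_family (\<lambda>q. \<Sum>i\<in>A. f i q)"
  by (induction A rule: infinite_finite_induct) (simp_all add: poly_family_zero poly_family_one poly_family_add)

lemma poly_family_prod: "(\<And>i. i \<in> A \<Longrightarrow> poly_family (f i)) \<Longrightarrow> poly_family (\<lambda>q. \<Prod>i\<in>A. f i q)"
  by (induction A rule: infinite_finite_induct) (simp_all add: poly_family_zero poly_family_one poly_family_mult)

lemma poly_family_one_minus_single:
  assumes "poly_fun f"
  shows "poly_family (\<lambda>q. 1 - Poly_Mapping.single e (f q))"
proof -
  have "poly_family (\<lambda>q. 1 + Poly_Mapping.single e (0 - f q))"
    using assms by (intro poly_family_add poly_family_one poly_family_single poly_fun_diff poly_fun_const)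
  then show ?thesis by (simp add: single_uminus)
qed

lemma poly_family_dyson: "poly_family (\<lambda>q. dyson q \<beta> S)"
proof -
  have "poly_family (\<lambda>q. qpoch_mon (f q) e q m)" if "poly_fun f" for f e m
    unfolding qpoch_mon_def using that
    by (intro poly_family_prod poly_family_one_minus_single poly_fun_mult poly_fun_power poly_fun_ident)
  then show ?thesis
    unfolding dyson_def dyson_pair_def
    by (auto simp: case_prod_beta intro!: poly_family_prod poly_family_mult poly_fun_const poly_fun_ident)
qed

text \<open>Each coefficient of a Cauchy product is a finite sum of products of lower coefficients,
  hence \<open>n\<close> is kept arbitrary in the induction.\<close>

lemma poly_family_fps_nth_prod:
  assumes "\<And>i n. i \<in> A \<Longrightarrow> poly_family (\<lambda>q. fps_nth (f i q) n)"
  shows "poly_family (\<lambda>q. fps_nth (\<Prod>i\<in>A. f i q) n)"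
  using assms
proof (induction A arbitrary: n rule: infinite_finite_induct)
  case (insert x A)
  have "poly_family (\<lambda>q. \<Sum>m=0..n. fps_nth (f x q) m * fps_nth (\<Prod>i\<in>A. f i q) (n - m))"
    using insert.prems by (intro poly_family_sum poly_family_mult insert.IH) simp_all
  then show ?case using insert.hyps by (simp add: fps_mult_nth)
qed (simp_all add: poly_family_zero poly_family_one fps_one_nth)

lemma poly_family_Fexp_on: "poly_family (\<lambda>q. fps_nth (Fexp_on q \<beta> S) n)"
proof -
  have "poly_family (\<lambda>q. fps_nth (geom q i b) n)" for i b n
    unfolding geom_def fps_nth_Abs_fps
    by (intro poly_family_single poly_fun_power poly_fun_ident)
  then have "poly_family (\<lambda>q. fps_nth (\<Prod>i\<in>S. \<Prod>b<\<beta> i. geom q i b) n)"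
    by (intro poly_family_fps_nth_prod)
  then show ?thesis
    unfolding Fexp_on_def fps_mult_left_const_nth by (intro poly_family_mult poly_family_dyson)
qed

lemma poly_fun_lookup_Fexp_on: "poly_fun (\<lambda>q. Poly_Mapping.lookup (fps_nth (Fexp_on q \<beta> S) n) k)"
  using poly_family_Fexp_on by (simp add: poly_family_def)

theorem theorem4p5:
  fixes s n :: nat and \<beta> :: "nat \<Rightarrow> nat" and q :: complex
  assumes "s \<ge> 1" and "\<forall>i\<in>{1..s}. \<beta> i > 0" and "n > 0"
  shows "(\<forall>k :: zexpo. Poly_Mapping.keys k \<subseteq> {1..s} \<longrightarrow> (\<forall>i\<in>{1..s}. Poly_Mapping.lookup k i < int n)
            \<longrightarrow> Poly_Mapping.lookup (fps_nth (Fexp q s \<beta>) n) k = 0)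
       \<and> (\<forall>a\<in>{1..s}. (\<forall>i\<in>{1..s}. qpoch q q (\<beta> i) \<noteq> 0) \<longrightarrow>
            Poly_Mapping.lookup (fps_nth (Fexp q s \<beta>) n) (Poly_Mapping.single a (int n)) =
              q ^ (\<Sum>j\<in>{a+1..s}. \<beta> j)
              * (1 - q ^ \<beta> a) * qpoch q q ((\<Sum>i\<in>{1..s}. \<beta> i) - \<beta> a)
              / (\<Prod>i\<in>{1..s}. qpoch q q (\<beta> i))
              * qpoch (q ^ ((\<Sum>i\<in>{1..s}. \<beta> i) - \<beta> a + n + 1)) q (\<beta> a - 1))"
proof (intro conjI allI ballI impI)
  let ?S = "{1..s}"
  have ne: "?S \<noteq> {}" using assms(1) by simp
  show "Poly_Mapping.lookup (fps_nth (Fexp q s \<beta>) n) k = 0"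
    if "\<forall>i\<in>?S. Poly_Mapping.lookup k i < int n" for k
    unfolding Fexp_eq
  proof (rule poly_fun_eqI[where x = q and g = "\<lambda>_. 0"
      and f = "\<lambda>q. Poly_Mapping.lookup (fps_nth (Fexp_on q \<beta> ?S) n) k"])
    show "Poly_Mapping.lookup (fps_nth (Fexp_on r \<beta> ?S) n) k = 0" if "generic r" for r
      using generic.lookup_Fexp_on_eq_0[OF that, of ?S \<beta> k n] ne assms(2)
        \<open>\<forall>i\<in>?S. Poly_Mapping.lookup k i < int n\<close> by auto
  qed (intro poly_fun_const poly_fun_lookup_Fexp_on)+
  fix a assume a: "a \<in> ?S" and nz: "\<forall>i\<in>?S. qpoch q q (\<beta> i) \<noteq> 0"
  let ?P = "\<lambda>q. \<Prod>i\<in>?S. qpoch q q (\<beta> i)"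
  let ?N = "\<lambda>q. q ^ dyson_tail \<beta> ?S a * (1 - q ^ \<beta> a) * qpoch q q (sum \<beta> (?S - {a}))
    * qpoch (q ^ (sum \<beta> (?S - {a}) + n + 1)) q (\<beta> a - 1)"
  \<comment> \<open>Multiplying by \<open>?P q\<close> makes both sides polynomial in
    \<open>q\<close>, so the identity extends from generic \<open>q\<close>; the assumption
    \<open>nz\<close> then permits dividing again.\<close>
  have "Poly_Mapping.lookup (fps_nth (Fexp_on q \<beta> ?S) n) (Poly_Mapping.single a (int n)) * ?P q = ?N q"
  proof (rule poly_fun_eqI[where x = q and g = ?N
      and f = "\<lambda>q. Poly_Mapping.lookup (fps_nth (Fexp_on q \<beta> ?S) n) (Poly_Mapping.single a (int n)) * ?P q"])
    fix r assume "generic r"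
    then interpret generic r .
    show "Poly_Mapping.lookup (fps_nth (Fexp_on r \<beta> ?S) n) (Poly_Mapping.single a (int n)) * ?P r = ?N r"
      using lookup_Fexp_on_single[of ?S \<beta> a n] assms(2,3) a qpoch_nonzero by simp
  qed (intro poly_fun_intros poly_fun_qpoch poly_fun_lookup_Fexp_on)+
  moreover have "?P q \<noteq> 0" using nz by simp
  ultimately have "Poly_Mapping.lookup (fps_nth (Fexp_on q \<beta> ?S) n) (Poly_Mapping.single a (int n)) = ?N q / ?P q"
    by (simp add: nonzero_eq_divide_eq)
  moreover have "dyson_tail \<beta> ?S a = (\<Sum>j\<in>{a+1..s}. \<beta> j)"
    unfolding dyson_tail_def by (intro sum.cong) auto
  moreover have "sum \<beta> (?S - {a}) = (\<Sum>i\<in>?S. \<beta> i) - \<beta> a"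
    using a by (simp add: sum_diff1_nat)
  ultimately show "Poly_Mapping.lookup (fps_nth (Fexp q s \<beta>) n) (Poly_Mapping.single a (int n)) =
      q ^ (\<Sum>j\<in>{a+1..s}. \<beta> j)
      * (1 - q ^ \<beta> a) * qpoch q q ((\<Sum>i\<in>?S. \<beta> i) - \<beta> a) / ?P q
      * qpoch (q ^ ((\<Sum>i\<in>?S. \<beta> i) - \<beta> a + n + 1)) q (\<beta> a - 1)"
    by (simp add: Fexp_eq)
qed

end
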